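(* For any finite simple undirected graph $G$ and any integer $r\ge 1$, $$D(G\boxtimes K_r,x)=D\bigl(G,(x+1)^r-1\bigr).$$
   Context: All graphs are finite, simple and undirected. A set $S\subseteq V(G)$ is dominating in $G$ if every vertex of $G$ is in $S$ or adjacent to a vertex of $S$. The domination polynomial is $D(G,x)=\sum_{i=0}^{|V(G)|} d_i(G)x^i$, where $d_i(G)$ is the number of dominating sets of $G$ of size $i$; $D(G,y)$ denotes the result of substituting $y$ for $x$. The strong product $G\boxtimes H$ has vertex set $V(G)\times V(H)$, with distinct vertices $(u_1,v_1)$ and $(u_2,v_2)$ adjacent iff ($u_1=u_2$ and $v_1v_2\in E(H)$) or ($u_1u_2\in E(G)$ and $v_1=v_2$) or ($u_1u_2\in E(G)$ and $v_1v_2\in E(H)$). $K_r$ is the complete graph on $r$ vertices. *)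

theory Defs
  imports "Graph_Theory.Kuratowski" "HOL-Computational_Algebra.Polynomial"
begin

text \<open>
  A finite simple undirected graph is a \<^locale>\<open>pair_graph\<close>: a finite loop-free digraph without
  parallel arcs whose arc relation is symmetric, an edge \<open>uv\<close> being the pair of
  arcs \<open>(u,v)\<close>, \<open>(v,u)\<close>. The null graph is allowed.
\<close>

definition dominating_set :: "'a pair_pre_digraph \<Rightarrow> 'a set \<Rightarrow> bool" where
  "dominating_set G S \<longleftrightarrow>
     S \<subseteq> pverts G \<and> (\<forall>v \<in> pverts G. v \<in> S \<or> (\<exists>u \<in> S. (v, u) \<in> parcs G))"

definition num_dominating_sets :: "'a pair_pre_digraph \<Rightarrow> nat \<Rightarrow> nat" where
  "num_dominating_sets G i = card {S. dominating_set G S \<and> card S = i}"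

text \<open>
  The coefficients are counts, but the polynomial is taken over \<^typ>\<open>int\<close> because
  polynomials with a negative constant term get substituted into it.
\<close>

definition domination_poly :: "'a pair_pre_digraph \<Rightarrow> int poly" where
  "domination_poly G = (\<Sum>i = 0..card (pverts G). monom (int (num_dominating_sets G i)) i)"

definition strong_product ::
    "'a pair_pre_digraph \<Rightarrow> 'b pair_pre_digraph \<Rightarrow> ('a \<times> 'b) pair_pre_digraph"
    (infixl \<open>\<boxtimes>\<close> 70) where
  "G \<boxtimes> H =
     \<lparr> pverts = pverts G \<times> pverts H,
       parcs = {((u\<^sub>1, v\<^sub>1), (u\<^sub>2, v\<^sub>2)) | u\<^sub>1 v\<^sub>1 u\<^sub>2 v\<^sub>2.
         (u\<^sub>1, v\<^sub>1) \<in> pverts G \<times> pverts H \<and> (u\<^sub>2, v\<^sub>2) \<in> pverts G \<times> pverts H \<and>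
         (u\<^sub>1, v\<^sub>1) \<noteq> (u\<^sub>2, v\<^sub>2) \<and>
         (u\<^sub>1 = u\<^sub>2 \<and> (v\<^sub>1, v\<^sub>2) \<in> parcs H \<or>
          (u\<^sub>1, u\<^sub>2) \<in> parcs G \<and> v\<^sub>1 = v\<^sub>2 \<or>
          (u\<^sub>1, u\<^sub>2) \<in> parcs G \<and> (v\<^sub>1, v\<^sub>2) \<in> parcs H)} \<rparr>"

lemma pair_graph_strong_product:
  assumes "pair_graph G" and "pair_graph H"
  shows "pair_graph (G \<boxtimes> H)"
proof -
  interpret G: pair_graph G by fact
  interpret H: pair_graph H by fact
  have fin: "finite (pverts (G \<boxtimes> H))"
    by (simp add: strong_product_def G.pair_finite_verts H.pair_finite_verts)
  have sub: "parcs (G \<boxtimes> H) \<subseteq> pverts (G \<boxtimes> H) \<times> pverts (G \<boxtimes> H)"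
    by (auto simp: strong_product_def)
  have symG: "(b, a) \<in> parcs G" if "(a, b) \<in> parcs G" for a b
    using that G.pair_sym_arcs by (simp add: symmetric_def sym_def)
  have symH: "(b, a) \<in> parcs H" if "(a, b) \<in> parcs H" for a b
    using that H.pair_sym_arcs by (simp add: symmetric_def sym_def)
  have "sym (parcs (G \<boxtimes> H))"
    by (rule symI) (auto simp: strong_product_def intro: symG symH)
  then show ?thesis
    using fin sub finite_subset[OF sub]
    by unfold_locales (auto simp: symmetric_def strong_product_def)
qed

end

theory Submission
  imports Defs "HOL-Library.FuncSet"
begin

text \<open>
  Written as a sum over sets instead of over sizes, the domination polynomial is
  \<open>D(G,x) = \<Sum>\<^sub>T x\<^bsup>|T|\<^esup>\<close>, with \<open>T\<close> running through the dominating sets of \<open>G\<close>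
  (\<open>pcompose_domination_poly\<close>). Replacing each vertex of \<open>G\<close> by a clique of \<open>r\<close> twins does not
  change which vertices of \<open>G\<close> are reached: a set \<open>S\<close> dominates \<open>G \<boxtimes> K\<^sub>r\<close> exactly when its
  projection to \<open>G\<close> dominates \<open>G\<close> (\<open>dominating_set_strong_product_complete_iff\<close>). The sets \<open>S\<close> that
  project onto a given \<open>T\<close> arise by choosing, independently for each \<open>t \<in> T\<close>, a nonempty subset of
  the clique over \<open>t\<close>. The generating function of those choices is \<open>(1 + x)\<^sup>r - 1\<close> for a single \<open>t\<close>,
  hence \<open>((1 + x)\<^sup>r - 1)\<^bsup>|T|\<^esup>\<close> for \<open>T\<close> (\<open>sum_power_card_sets_over\<close>), which is the term of \<open>T\<close> in
  \<open>D(G, (1 + x)\<^sup>r - 1)\<close>.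
\<close>

lemma finite_dominating_sets:
  assumes "finite (pverts G)"
  shows "finite {S. dominating_set G S}"
  by (rule finite_subset[of _ "Pow (pverts G)"]) (auto simp: dominating_set_def assms)

text \<open>
  Grouping the dominating sets by size turns the sum over sets into the defining sum over sizes.
  The statement has an arbitrary argument \<open>q\<close>, so that it serves both for \<open>D(G \<boxtimes> K\<^sub>r, x)\<close>, with
  \<open>q = x\<close>, and for the substituted polynomial.
\<close>

lemma pcompose_domination_poly:
  assumes "finite (pverts G)"
  shows "pcompose (domination_poly G) q = (\<Sum>S | dominating_set G S. q ^ card S)"
proof -
  let ?\<D> = "{S. dominating_set G S}"
  have pcompose_monom: "pcompose (monom c i) q = smult c (q ^ i)" for c :: int and i
    by (induction i) (simp_all add: monom_0 monom_Suc pcompose_pCons)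
  have sizes: "card ` ?\<D> \<subseteq> {0..card (pverts G)}"
    using assms by (auto simp: dominating_set_def intro: card_mono)
  have "(\<Sum>S\<in>?\<D>. q ^ card S)
      = (\<Sum>i = 0..card (pverts G). of_nat (card {S \<in> ?\<D>. card S = i}) * q ^ i)"
    by (rule sum_fun_comp) (use sizes in \<open>auto simp: finite_dominating_sets assms\<close>)
  then show ?thesis
    by (simp add: domination_poly_def num_dominating_sets_def pcompose_sum pcompose_monom
        of_nat_poly)
qed

text \<open>
  A vertex \<open>(v, w)\<close> is dominated by every vertex \<open>(u, w')\<close> for which \<open>u\<close> is equal or adjacent to
  \<open>v\<close>, whatever \<open>w\<close> and \<open>w'\<close> are, since any two vertices of \<open>K\<close> are equal or adjacent. Conversely,
  to see that \<open>v\<close> is dominated by the projection one looks at some vertex over \<open>v\<close>, and one exists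
  because \<open>K\<close> is nonempty.
\<close>

lemma dominating_set_strong_product_complete_iff:
  assumes G: "pair_graph G"
    and K: "parcs K = {(v, w). (v, w) \<in> pverts K \<times> pverts K \<and> v \<noteq> w}" "pverts K \<noteq> {}"
  shows "dominating_set (G \<boxtimes> K) S
    \<longleftrightarrow> S \<subseteq> pverts G \<times> pverts K \<and> dominating_set G (fst ` S)"
proof (cases "S \<subseteq> pverts G \<times> pverts K")
  case True
  interpret G: pair_graph G by fact
  have no_loop: "(v, v) \<notin> parcs G" for v
    using G.pair_no_loops by fastforce
  have verts: "pverts (G \<boxtimes> K) = pverts G \<times> pverts K"
    by (simp add: strong_product_def)
  have arc_iff: "(v, w) = s \<or> ((v, w), s) \<in> parcs (G \<boxtimes> K) \<longleftrightarrow> v = fst s \<or> (v, fst s) \<in> parcs G"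
    if "v \<in> pverts G" "w \<in> pverts K" "s \<in> S" for v w s
    using that True no_loop by (cases s) (auto simp: strong_product_def K(1))
  have "dominating_set (G \<boxtimes> K) S
      \<longleftrightarrow> (\<forall>v \<in> pverts G. \<forall>w \<in> pverts K. \<exists>s \<in> S. (v, w) = s \<or> ((v, w), s) \<in> parcs (G \<boxtimes> K))"
    using True unfolding dominating_set_def verts by blast
  also have "\<dots> \<longleftrightarrow> (\<forall>v \<in> pverts G. \<exists>s \<in> S. v = fst s \<or> (v, fst s) \<in> parcs G)"
    using K(2) by (auto simp: arc_iff cong: bex_cong)
  also have "\<dots> \<longleftrightarrow> dominating_set G (fst ` S)"
    using True by (fastforce simp: dominating_set_def)
  finally show ?thesis
    using True by simp
qed (simp add: dominating_set_def strong_product_def)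

lemma sum_power_card_Pow:
  fixes x :: "'c::comm_semiring_1"
  assumes "finite W"
  shows "(\<Sum>A\<in>Pow W. x ^ card A) = (1 + x) ^ card W"
  using prod_add[OF assms, of "\<lambda>_. x" "\<lambda>_. 1"] by (simp add: add.commute)

text \<open>
  A set \<open>S \<subseteq> T \<times> W\<close> projecting onto \<open>T\<close> is the same as a family of nonempty fibres
  \<open>f t \<subseteq> W\<close>, one for each \<open>t \<in> T\<close>, and its size is the sum of the sizes of the fibres. The sum over
  \<open>S\<close> therefore factors into one sum over nonempty subsets of \<open>W\<close> for each \<open>t\<close>.
\<close>

lemma sum_power_card_sets_over:
  fixes x :: "'c::comm_ring_1"
  assumes "finite T" "finite W"
  shows "(\<Sum>S | S \<subseteq> T \<times> W \<and> fst ` S = T. x ^ card S) = ((1 + x) ^ card W - 1) ^ card T"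
proof -
  let ?F = "T \<rightarrow>\<^sub>E (Pow W - {{}})"
  have nonempty: "(\<Sum>A\<in>Pow W - {{}}. x ^ card A) = (1 + x) ^ card W - 1"
    using assms by (simp add: sum_diff1 sum_power_card_Pow)
  have "(\<Sum>S | S \<subseteq> T \<times> W \<and> fst ` S = T. x ^ card S) = (\<Sum>f\<in>?F. \<Prod>t\<in>T. x ^ card (f t))"
  proof (rule sum.reindex_bij_witness[where i = "Sigma T" and j = "\<lambda>S. \<lambda>t\<in>T. S `` {t}"])
    fix S assume S: "S \<in> {S. S \<subseteq> T \<times> W \<and> fst ` S = T}"
    show S_eq: "Sigma T (\<lambda>t\<in>T. S `` {t}) = S"
      using S by (auto split: if_splits)
    show "(\<lambda>t\<in>T. S `` {t}) \<in> ?F"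
      using S by (auto simp: restrict_PiE_iff)
    have "\<forall>t\<in>T. finite (S `` {t})"
      using S assms by (auto intro: finite_subset[of _ W])
    then have "card (Sigma T (\<lambda>t\<in>T. S `` {t})) = (\<Sum>t\<in>T. card ((\<lambda>t\<in>T. S `` {t}) t))"
      using assms by (intro card_SigmaI) auto
    then show "(\<Prod>t\<in>T. x ^ card ((\<lambda>t\<in>T. S `` {t}) t)) = x ^ card S"
      by (simp only: S_eq power_sum)
  next
    fix f assume f: "f \<in> ?F"
    show "(\<lambda>t\<in>T. Sigma T f `` {t}) = f"
      using f by (auto simp: fun_eq_iff restrict_def PiE_def extensional_def)
    show "Sigma T f \<in> {S. S \<subseteq> T \<times> W \<and> fst ` S = T}"
      using f by (fastforce simp: PiE_iff image_iff)
  qed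
  also have "\<dots> = (\<Prod>t\<in>T. \<Sum>A\<in>Pow W - {{}}. x ^ card A)"
    using assms by (intro prod_sum_PiE[symmetric]) auto
  finally show ?thesis
    by (simp add: nonempty)
qed

theorem theorem2p2:
  fixes G :: "'a pair_pre_digraph" and K :: "'b pair_pre_digraph" and r :: nat
  assumes "pair_graph G"
    and "r \<ge> 1"
    and "complete_digraph r (with_proj K)"
  shows "domination_poly (G \<boxtimes> K) = pcompose (domination_poly G) ([:1, 1:] ^ r - 1)"
proof -
  interpret G: pair_graph G by fact
  let ?V = "pverts G" and ?W = "pverts K" and ?x = "[:0, 1:] :: int poly"
  have W: "finite ?W" "card ?W = r"
    and arcs_K: "parcs K = {(v, w). (v, w) \<in> ?W \<times> ?W \<and> v \<noteq> w}"
    using assms(3) by (auto simp: complete_digraph_pair_def)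
  have "?W \<noteq> {}"
    using W assms(2) by auto
  note dom_iff = dominating_set_strong_product_complete_iff[OF assms(1) arcs_K this]
  have fin: "finite (pverts (G \<boxtimes> K))"
    using W by (simp add: strong_product_def)
  have "domination_poly (G \<boxtimes> K) = pcompose (domination_poly (G \<boxtimes> K)) ?x"
    by simp
  also have "\<dots> = (\<Sum>S | dominating_set (G \<boxtimes> K) S. ?x ^ card S)"
    by (rule pcompose_domination_poly[OF fin])
  also have "\<dots> = (\<Sum>T | dominating_set G T.
      \<Sum>S | S \<in> {S. dominating_set (G \<boxtimes> K) S} \<and> fst ` S = T. ?x ^ card S)"
    by (rule sum.group[OF finite_dominating_sets[OF fin] finite_dominating_sets, symmetric])
      (auto simp: dom_iff)
  also have "\<dots> = (\<Sum>T | dominating_set G T. ((1 + ?x) ^ r - 1) ^ card T)"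
  proof (rule sum.cong[OF refl])
    fix T assume T: "T \<in> {T. dominating_set G T}"
    then have "T \<subseteq> ?V"
      by (simp add: dominating_set_def)
    then have "finite T"
      by (rule finite_subset) simp
    have "{S. S \<in> {S. dominating_set (G \<boxtimes> K) S} \<and> fst ` S = T} = {S. S \<subseteq> T \<times> ?W \<and> fst ` S = T}"
      using T \<open>T \<subseteq> ?V\<close> by (force simp: dom_iff)
    with sum_power_card_sets_over[OF \<open>finite T\<close> W(1), of ?x] W(2)
    show "(\<Sum>S | S \<in> {S. dominating_set (G \<boxtimes> K) S} \<and> fst ` S = T. ?x ^ card S)
        = ((1 + ?x) ^ r - 1) ^ card T"
      by simp
  qed
  also have "\<dots> = pcompose (domination_poly G) ((1 + ?x) ^ r - 1)"
    by (rule pcompose_domination_poly[symmetric]) simp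
  also have "1 + ?x = [:1, 1:]"
    by (simp add: one_pCons)
  finally show ?thesis .
qed

end
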